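(* Let $B_1,B_2>0$, $W>0$, $\alpha\in(0,1]$, $\beta\in(0,1]$, and $W_1,W_2\ge0$ with $W_1+W_2=(1-\beta)W$. (First scenario: one large SP, $N$ small SPs.) If $$B_1+W_1+2(1-\alpha)\frac{W_1}{B_1}>2(1-\alpha)\frac{2\beta W+W_2}{B_2},$$ then there exists $N^*$ such that for all $N\ge N^*$ SP 1 (the large SP) does not use the open access spectrum at equilibrium, i.e. $w_1^*(N)=0$. (Second scenario: $N$ large SPs and $N$ small SPs, $B_1\ge B_2$.) Let $i,j\in\{1,2\}$, $i\ne j$. If $$\frac{W_i}{B_i}>\frac{2\beta W+W_j}{B_j},$$ then there is an $N^{**}$ such that for all $N\ge N^{**}$ the SPs of group $i$ do not use the open access spectrum at equilibrium (group $1$ consists of the larger SPs and group $2$ of the smaller SPs).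
   Context: Service providers (SPs) play a one-shot Cournot game. An SP $s$ with always-available proprietary bandwidth $b_s$ and licensed shared bandwidth $v_s$ chooses $x_s\ge 0$ (traffic on its own bands, proprietary plus licensed shared) and $w_s\ge 0$ (traffic on the open access band, which has bandwidth $\beta W$ and is common to all SPs). All shared bandwidth is simultaneously available with probability $\alpha$. With delivered price $p_d=1-\sum_{r}(x_r+w_r)$ (sum over all SPs), the prices obtained by SP $s$ are $$p_s=p_d-(1-\alpha)\frac{x_s+w_s}{b_s}-\alpha\frac{x_s}{b_s+v_s},\qquad p_s^w=p_d-\alpha\frac{\sum_r w_r}{\beta W}-(1-\alpha)\frac{x_s+w_s}{b_s},$$ and SP $s$ maximizes $R_s=p_sx_s+p_s^ww_s$. Equilibrium means pure Nash equilibrium (it is unique). First scenario: SP 1 has $b=B_1$, $v=W_1$; there are $N$ further small SPs, each with $b=B_2/N$, $v=W_2/N$; $w_1^*(N)$ is SP 1's equilibrium open access traffic. Second scenario: there are $2N$ SPs in two groups of $N$; each SP in group $k\in\{1,2\}$ has $b=B_k/N$, $v=W_k/N$. "Does not use the open access spectrum" means that its equilibrium $w_s$ equals $0$.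
   Formalization: In the second scenario the formal theorem assumes α<1 instead of α≤1; at α=1 the claim is false (e.g. W=1, β=1/2, B_1=1, B_2=1/10, W_1=0, W_2=1/2, i=2, j=1). *)

theory Defs
  imports Complex_Main
begin

text \<open>
  The Cournot game among a finite set \<open>S\<close> of service providers. The parameter \<open>oa\<close> is the
  bandwidth of the open access band (\<open>\<beta> * W\<close> in the intended use); \<open>b\<close> and \<open>v\<close> give the proprietary
  and licensed shared bandwidth of each provider. A strategy profile consists of the functions
  \<open>x\<close> (traffic on own bands) and \<open>w\<close> (open access traffic), of which only the values on \<open>S\<close> matter.
\<close>

definition delivered_price :: "'s set \<Rightarrow> ('s \<Rightarrow> real) \<Rightarrow> ('s \<Rightarrow> real) \<Rightarrow> real" where
  "delivered_price S x w = 1 - (\<Sum>r\<in>S. x r + w r)"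

definition own_price ::
  "real \<Rightarrow> 's set \<Rightarrow> ('s \<Rightarrow> real) \<Rightarrow> ('s \<Rightarrow> real) \<Rightarrow> ('s \<Rightarrow> real) \<Rightarrow> ('s \<Rightarrow> real) \<Rightarrow> 's \<Rightarrow> real" where
  "own_price \<alpha> S b v x w s =
     delivered_price S x w - (1 - \<alpha>) * ((x s + w s) / b s) - \<alpha> * (x s / (b s + v s))"

definition open_price ::
  "real \<Rightarrow> real \<Rightarrow> 's set \<Rightarrow> ('s \<Rightarrow> real) \<Rightarrow> ('s \<Rightarrow> real) \<Rightarrow> ('s \<Rightarrow> real) \<Rightarrow> 's \<Rightarrow> real" where
  "open_price \<alpha> oa S b x w s =
     delivered_price S x w - \<alpha> * ((\<Sum>r\<in>S. w r) / oa) - (1 - \<alpha>) * ((x s + w s) / b s)"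

definition revenue ::
  "real \<Rightarrow> real \<Rightarrow> 's set \<Rightarrow> ('s \<Rightarrow> real) \<Rightarrow> ('s \<Rightarrow> real) \<Rightarrow> ('s \<Rightarrow> real) \<Rightarrow> ('s \<Rightarrow> real) \<Rightarrow> 's \<Rightarrow> real" where
  "revenue \<alpha> oa S b v x w s =
     own_price \<alpha> S b v x w s * x s + open_price \<alpha> oa S b x w s * w s"

definition nash_equilibrium ::
  "real \<Rightarrow> real \<Rightarrow> 's set \<Rightarrow> ('s \<Rightarrow> real) \<Rightarrow> ('s \<Rightarrow> real) \<Rightarrow> ('s \<Rightarrow> real) \<Rightarrow> ('s \<Rightarrow> real) \<Rightarrow> bool" where
  "nash_equilibrium \<alpha> oa S b v x w \<longleftrightarrow>
     (\<forall>s\<in>S. x s \<ge> 0 \<and> w s \<ge> 0) \<and>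
     (\<forall>s\<in>S. \<forall>x' \<ge> 0. \<forall>w' \<ge> 0.
        revenue \<alpha> oa S b v (x(s := x')) (w(s := w')) s \<le> revenue \<alpha> oa S b v x w s)"

text \<open>
  The equilibrium of the game is unique, so "the equilibrium has property \<open>P\<close>" is rendered as:
  an equilibrium exists, and every equilibrium has property \<open>P\<close>; the existence conjunct keeps the
  claim from being vacuous.
\<close>

definition unused_open_access_at_equilibrium ::
  "real \<Rightarrow> real \<Rightarrow> 's set \<Rightarrow> ('s \<Rightarrow> real) \<Rightarrow> ('s \<Rightarrow> real) \<Rightarrow> 's set \<Rightarrow> bool" where
  "unused_open_access_at_equilibrium \<alpha> oa S b v T \<longleftrightarrow>
     (\<exists>x w. nash_equilibrium \<alpha> oa S b v x w) \<and>
     (\<forall>x w. nash_equilibrium \<alpha> oa S b v x w \<longrightarrow> (\<forall>s\<in>T. w s = 0))"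

text \<open>
  First scenario: provider \<open>1\<close> is the large one and \<open>2, \<dots>, N + 1\<close> are the \<open>N\<close> small ones. For an
  aggregate bandwidth \<open>C\<close> (\<open>C 1\<close> of the large provider, \<open>C 2\<close> of all small ones together),
  \<open>one_large_bw C N\<close> is the resulting bandwidth of each provider.
\<close>

definition one_large_sps :: "nat \<Rightarrow> nat set" where
  "one_large_sps N = {1..N + 1}"

definition one_large_bw :: "(nat \<Rightarrow> real) \<Rightarrow> nat \<Rightarrow> nat \<Rightarrow> real" where
  "one_large_bw C N s = (if s = 1 then C 1 else C 2 / real N)"

text \<open>
  Second scenario: provider \<open>(k, m)\<close> is the \<open>m\<close>-th of the \<open>N\<close> members of group \<open>k\<close>.
\<close>

definition two_group_sps :: "nat \<Rightarrow> (nat \<times> nat) set" where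
  "two_group_sps N = {1, 2} \<times> {1..N}"

definition two_group_bw :: "(nat \<Rightarrow> real) \<Rightarrow> nat \<Rightarrow> nat \<times> nat \<Rightarrow> real" where
  "two_group_bw C N s = C (fst s) / real N"

end

theory Submission
  imports Defs "HOL-Analysis.Function_Topology"
begin

text \<open>
  Existence: the game has an exact potential, and since a provider carrying traffic at least \<open>1\<close>
  earns nothing, a maximum point of the potential over the box \<open>[0, 1]\<close> is an equilibrium.

  For the vanishing of \<open>w s\<close>: at an equilibrium every provider uses its own bands. If \<open>w s > 0\<close>, both
  first order conditions of \<open>s\<close> are equalities, so that \<open>t = x s / (b s + v s)\<close> fixes the open access
  traffic: \<open>2 * oa * t\<close> is the total plus \<open>w s\<close>. Summing the conditions of the \<open>N\<close> providers of the other
  group bounds their aggregate traffic, and eliminating the common price leaves, after division by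
  \<open>t\<close>, an inequality between bandwidths that contradicts the hypothesis as \<open>N\<close> grows.
\<close>

text \<open>Revenue is quadratic in each own variable: changing it by \<open>h\<close> gains
  \<open>h * D - c * h\<^sup>2\<close>, which is never positive at an optimum. Taking
  \<open>h\<close> with the sign of \<open>D\<close>, dividing by its size and letting it tend to 0
  leaves \<open>\<bar>D\<bar> \<le> 0\<close>. Downward steps are feasible only if
  \<open>y > 0\<close>.\<close>

lemma first_order_condition:
  fixes D c y :: real
  assumes "y \<ge> 0" and "\<And>h. h \<ge> - y \<Longrightarrow> h * D \<le> c * h\<^sup>2"
  shows "D \<le> 0" and "y > 0 \<Longrightarrow> D = 0"
proof -
  have bound: "\<bar>D\<bar> \<le> c * e" if "e > 0" "D \<noteq> 0" "sgn D * e \<ge> - y" for e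
  proof -
    have "e * \<bar>D\<bar> \<le> e * (c * e)"
      using assms(2)[OF that(3)] that(2) by (auto simp: sgn_if power2_eq_square algebra_simps split: if_splits)
    then show ?thesis using that(1) by simp
  qed
  have le: "\<bar>D\<bar> \<le> 0" if "D \<noteq> 0" "d > 0" "\<And>e. 0 < e \<Longrightarrow> e < d \<Longrightarrow> sgn D * e \<ge> - y" for d
  proof (rule tendsto_lowerbound)
    show "((\<lambda>e. c * e) \<longlongrightarrow> 0) (at_right 0)"
      by (auto intro!: tendsto_eq_intros)
    show "\<forall>\<^sub>F e in at_right 0. \<bar>D\<bar> \<le> c * e"
      using that bound by (auto simp: eventually_at_right_field)
  qed simp
  show "D \<le> 0"
  proof (rule ccontr)
    assume "\<not> D \<le> 0"
    then show False using le[of 1] assms(1) by (auto simp: sgn_if)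
  qed
  show "D = 0" if "y > 0"
    using le[OF _ that] by (fastforce simp: sgn_if)
qed

section \<open>Exact potential and existence of an equilibrium\<close>

locale cournot_game =
  fixes \<alpha> oa :: real and S :: "'s set" and b v :: "'s \<Rightarrow> real"
  assumes finite_S: "finite S"
    and \<alpha>: "0 < \<alpha>" "\<alpha> \<le> 1"
    and oa: "oa > 0"
    and b: "\<And>s. s \<in> S \<Longrightarrow> b s > 0"
    and v: "\<And>s. s \<in> S \<Longrightarrow> v s \<ge> 0"
begin

text \<open>Half of (square of the sum plus sum of squares) contains every square and every mixed
  product exactly once. Seen from \<open>s\<close> this is the own square plus the own amount times
  the rivals' total, which is the shape of the interaction terms in its revenue.\<close>

definition potential :: "('s \<Rightarrow> real) \<Rightarrow> ('s \<Rightarrow> real) \<Rightarrow> real" where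
  "potential x w =
     (\<Sum>r\<in>S. x r + w r) - ((\<Sum>r\<in>S. x r + w r)\<^sup>2 + (\<Sum>r\<in>S. (x r + w r)\<^sup>2)) / 2
     - (\<Sum>r\<in>S. (1 - \<alpha>) * ((x r + w r)\<^sup>2 / b r)) - (\<Sum>r\<in>S. \<alpha> * ((x r)\<^sup>2 / (b r + v r)))
     - \<alpha> / oa * (((\<Sum>r\<in>S. w r)\<^sup>2 + (\<Sum>r\<in>S. (w r)\<^sup>2)) / 2)"

lemma sum_upd:
  fixes f :: "real \<Rightarrow> real \<Rightarrow> 's \<Rightarrow> real"
  assumes "s \<in> S"
  shows "(\<Sum>r\<in>S. f ((x(s := x')) r) ((w(s := w')) r) r)
    = f x' w' s + (\<Sum>r\<in>S - {s}. f (x r) (w r) r)"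
  using finite_S assms by (subst sum.remove[of S s]) (auto intro!: sum.cong)

text \<open>Rivals enter only through two aggregates, separated here from the choice of
  \<open>s\<close>. Taking \<open>x' = x s\<close> and \<open>w' = w s\<close> covers the original
  profile too.\<close>

lemma revenue_upd:
  assumes "s \<in> S"
  shows "revenue \<alpha> oa S b v (x(s := x')) (w(s := w')) s =
    (1 - (\<Sum>r\<in>S - {s}. x r + w r) - (x' + w')) * (x' + w') - (1 - \<alpha>) * ((x' + w')\<^sup>2 / b s)
    - \<alpha> * (x'\<^sup>2 / (b s + v s)) - \<alpha> / oa * (w' * ((\<Sum>r\<in>S - {s}. w r) + w'))"
  unfolding revenue_def own_price_def open_price_def delivered_price_def
    sum_upd[OF assms, of "\<lambda>a b _. a + b"] sum_upd[OF assms, of "\<lambda>_ b _. b"]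
  by (simp add: power2_eq_square diff_divide_distrib add_divide_distrib algebra_simps)

lemma potential_upd:
  assumes "s \<in> S"
  shows "potential (x(s := x')) (w(s := w')) - potential x w =
    revenue \<alpha> oa S b v (x(s := x')) (w(s := w')) s - revenue \<alpha> oa S b v x w s"
proof -
  \<comment> \<open>Potential minus revenue of \<open>s\<close> does not depend on what
    \<open>s\<close> plays, so it equals its value at 0, where the revenue vanishes.\<close>
  have split: "potential (x(s := x')) (w(s := w')) =
      revenue \<alpha> oa S b v (x(s := x')) (w(s := w')) s + potential (x(s := 0)) (w(s := 0))" for x' w'
    unfolding revenue_upd[OF assms] potential_def
      sum_upd[OF assms, of "\<lambda>a b _. a + b"] sum_upd[OF assms, of "\<lambda>_ b _. b"]
      sum_upd[OF assms, of "\<lambda>a b _. (a + b)\<^sup>2"] sum_upd[OF assms, of "\<lambda>_ b _. b\<^sup>2"]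
      sum_upd[OF assms, of "\<lambda>c d r. (1 - \<alpha>) * ((c + d)\<^sup>2 / b r)"]
      sum_upd[OF assms, of "\<lambda>c _ r. \<alpha> * (c\<^sup>2 / (b r + v r))"]
    by (simp add: power2_eq_square diff_divide_distrib add_divide_distrib algebra_simps)
  show ?thesis
    using split[of x' w'] split[of "x s" "w s"] by simp
qed

lemma revenue_le_0:
  assumes "s \<in> S" and "x' + w' \<ge> 1" and "x' \<ge> 0" "w' \<ge> 0"
    and nonneg: "\<And>r. r \<in> S \<Longrightarrow> x r \<ge> 0 \<and> w r \<ge> 0"
  shows "revenue \<alpha> oa S b v (x(s := x')) (w(s := w')) s \<le> 0"
proof -
  have "(\<Sum>r\<in>S - {s}. x r + w r) \<ge> 0" "(\<Sum>r\<in>S - {s}. w r) \<ge> 0"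
    using nonneg by (auto intro!: sum_nonneg)
  then have "(1 - (\<Sum>r\<in>S - {s}. x r + w r) - (x' + w')) * (x' + w') \<le> 0"
    "\<alpha> / oa * (w' * ((\<Sum>r\<in>S - {s}. w r) + w')) \<ge> 0"
    "(1 - \<alpha>) * ((x' + w')\<^sup>2 / b s) \<ge> 0" "\<alpha> * (x'\<^sup>2 / (b s + v s)) \<ge> 0"
    using assms(2-4) \<alpha> oa b[OF assms(1)] v[OF assms(1)]
    by (auto intro!: mult_nonpos_nonneg mult_nonneg_nonneg divide_nonneg_nonneg)
  then show ?thesis
    unfolding revenue_upd[OF assms(1)] by linarith
qed

lemma nash_equilibrium_exists: "\<exists>x w. nash_equilibrium \<alpha> oa S b v x w"
proof -
  \<comment> \<open>All coordinates are boxed, also those outside \<open>S\<close>, so that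
    Tychonoff gives compactness in the topology of the function type.\<close>
  define K :: "('s \<Rightarrow> real) set" where "K = (\<Pi>\<^sub>E i\<in>UNIV. {0..1})"
  have K: "f \<in> K \<longleftrightarrow> (\<forall>i. 0 \<le> f i \<and> f i \<le> 1)" for f
    unfolding K_def PiE_UNIV_domain Pi_iff by auto
  have "compactin (product_topology (\<lambda>i. euclidean) UNIV) K"
    unfolding K_def by (simp add: compactin_PiE)
  then have "compact K"
    by (simp add: euclidean_product_topology)
  then have "compact (K \<times> K)"
    by (intro compact_Times)
  moreover have "(\<lambda>_. 0, \<lambda>_. 0) \<in> K \<times> K"
    by (simp add: K)
  moreover have "continuous_on (K \<times> K) (\<lambda>p. potential (fst p) (snd p))"
  proof -
    have "continuous_on (K \<times> K) (\<lambda>p. fst p i)" "continuous_on (K \<times> K) (\<lambda>p. snd p i)" for i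
      by (rule continuous_on_product_then_coordinatewise, intro continuous_intros)+
    \<comment> \<open>Quotients become products with constant inverses, so no denominator has to be
      shown nonzero.\<close>
    then show ?thesis
      unfolding potential_def divide_inverse
      by (intro continuous_on_add continuous_on_diff continuous_on_mult continuous_on_power
          continuous_on_sum continuous_on_const)
  qed
  ultimately obtain p where p: "p \<in> K \<times> K"
    "\<And>q. q \<in> K \<times> K \<Longrightarrow> potential (fst q) (snd q) \<le> potential (fst p) (snd p)"
    using continuous_attains_sup[of "K \<times> K" "\<lambda>p. potential (fst p) (snd p)"] by blast
  define x w where "x = fst p" and "w = snd p"
  have nonneg: "x r \<ge> 0 \<and> w r \<ge> 0" for r
    using p(1) by (auto simp: x_def w_def K mem_Times_iff)
  have box: "revenue \<alpha> oa S b v (x(s := x')) (w(s := w')) s \<le> revenue \<alpha> oa S b v x w s"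
    if "s \<in> S" "0 \<le> x'" "x' \<le> 1" "0 \<le> w'" "w' \<le> 1" for s x' w'
  proof -
    have "(x(s := x'), w(s := w')) \<in> K \<times> K"
      using p(1) that by (auto simp: x_def w_def K mem_Times_iff)
    then have "potential (x(s := x')) (w(s := w')) \<le> potential x w"
      using p(2) unfolding x_def w_def by fastforce
    then show ?thesis
      using potential_upd[OF that(1), of x x' w w'] by simp
  qed
  have "revenue \<alpha> oa S b v (x(s := x')) (w(s := w')) s \<le> revenue \<alpha> oa S b v x w s"
    if "s \<in> S" "0 \<le> x'" "0 \<le> w'" for s x' w'
  \<comment> \<open>Leaving the box is no better than playing 0, which lies in the box.\<close>
  proof (cases "x' \<le> 1 \<and> w' \<le> 1")
    case False
    then have "revenue \<alpha> oa S b v (x(s := x')) (w(s := w')) s \<le> 0"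
      using that nonneg by (intro revenue_le_0) auto
    also have "0 = revenue \<alpha> oa S b v (x(s := 0)) (w(s := 0)) s"
      by (simp add: revenue_upd[OF that(1)])
    also have "\<dots> \<le> revenue \<alpha> oa S b v x w s"
      using that by (intro box) auto
    finally show ?thesis .
  qed (use that box in auto)
  then show ?thesis
    using nonneg unfolding nash_equilibrium_def by blast
qed

end

section \<open>First order conditions and the bandwidth inequality at an equilibrium\<close>

locale cournot_equilibrium = cournot_game +
  fixes x w
  assumes equilibrium: "nash_equilibrium \<alpha> oa S b v x w"
begin

lemma nonneg: "s \<in> S \<Longrightarrow> x s \<ge> 0" "s \<in> S \<Longrightarrow> w s \<ge> 0"
  using equilibrium by (auto simp: nash_equilibrium_def)

text \<open>
  The part common to the derivatives of the revenue of \<open>s\<close> in \<open>x s\<close> and in \<open>w s\<close>; the conditions below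
  compare it with the marginal congestion cost of the own and of the open access bands.
\<close>

definition marginal :: "'a \<Rightarrow> real" where
  "marginal s = 1 - (\<Sum>r\<in>S. x r + w r) - (x s + w s) * (1 + 2 * (1 - \<alpha>) / b s)"

text \<open>The trivial update on the right lets \<open>revenue_upd\<close> rewrite both
  sides.\<close>

lemma deviation:
  assumes "s \<in> S" "x' \<ge> 0" "w' \<ge> 0"
  shows "revenue \<alpha> oa S b v (x(s := x')) (w(s := w')) s
    \<le> revenue \<alpha> oa S b v (x(s := x s)) (w(s := w s)) s"
  using equilibrium assms by (auto simp: nash_equilibrium_def)

lemma sum_S:
  fixes f :: "'a \<Rightarrow> real"
  assumes "s \<in> S"
  shows "sum f S = f s + sum f (S - {s})"
  using finite_S assms by (rule sum.remove)

lemma x_condition: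
  assumes "s \<in> S"
  shows "marginal s \<le> 2 * \<alpha> * (x s / (b s + v s))"
    and "x s > 0 \<Longrightarrow> marginal s = 2 * \<alpha> * (x s / (b s + v s))"
proof -
  define A where "A = (\<Sum>r\<in>S - {s}. x r + w r)"
  define D where "D = marginal s - 2 * \<alpha> * (x s / (b s + v s))"
  have D: "D = 1 - A - 2 * (x s + w s) - 2 * (1 - \<alpha>) / b s * (x s + w s) - 2 * \<alpha> / (b s + v s) * x s"
    unfolding D_def marginal_def A_def sum_S[OF assms] by (simp add: algebra_simps)
  \<comment> \<open>\<open>D\<close> is the partial derivative in \<open>x s\<close>; the factor of
    \<open>h\<^sup>2\<close> is minus the coefficient of the square of \<open>x'\<close> in the
    revenue.\<close>
  have "h * D \<le> (1 + (1 - \<alpha>) / b s + \<alpha> / (b s + v s)) * h\<^sup>2" if "h \<ge> - x s" for h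
  proof -
    have "revenue \<alpha> oa S b v (x(s := x s + h)) (w(s := w s)) s
      - revenue \<alpha> oa S b v (x(s := x s)) (w(s := w s)) s
      = h * D - (1 + (1 - \<alpha>) / b s + \<alpha> / (b s + v s)) * h\<^sup>2"
      unfolding revenue_upd[OF assms] A_def[symmetric] D
      unfolding divide_inverse by (simp add: power2_eq_square algebra_simps)
    then show ?thesis
      using deviation[OF assms, of "x s + h" "w s"] that nonneg(2)[OF assms] by simp
  qed
  from first_order_condition[OF nonneg(1)[OF assms] this]
  show "marginal s \<le> 2 * \<alpha> * (x s / (b s + v s))"
    and "x s > 0 \<Longrightarrow> marginal s = 2 * \<alpha> * (x s / (b s + v s))"
    by (auto simp: D_def)
qed

text \<open>The extra \<open>w s\<close> arises because open access congestion costs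
  \<open>w'\<close> times a total that itself contains \<open>w'\<close>.\<close>

lemma w_condition:
  assumes "s \<in> S"
  shows "marginal s \<le> \<alpha> / oa * (sum w S + w s)"
    and "w s > 0 \<Longrightarrow> marginal s = \<alpha> / oa * (sum w S + w s)"
proof -
  define A where "A = (\<Sum>r\<in>S - {s}. x r + w r)"
  define C where "C = (\<Sum>r\<in>S - {s}. w r)"
  define D where "D = marginal s - \<alpha> / oa * (sum w S + w s)"
  have D: "D = 1 - A - 2 * (x s + w s) - 2 * (1 - \<alpha>) / b s * (x s + w s) - \<alpha> / oa * (C + 2 * w s)"
    unfolding D_def marginal_def A_def C_def sum_S[OF assms] by (simp add: algebra_simps)
  have "h * D \<le> (1 + (1 - \<alpha>) / b s + \<alpha> / oa) * h\<^sup>2" if "h \<ge> - w s" for h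
  proof -
    have "revenue \<alpha> oa S b v (x(s := x s)) (w(s := w s + h)) s
      - revenue \<alpha> oa S b v (x(s := x s)) (w(s := w s)) s
      = h * D - (1 + (1 - \<alpha>) / b s + \<alpha> / oa) * h\<^sup>2"
      unfolding revenue_upd[OF assms] A_def[symmetric] C_def[symmetric] D
      unfolding divide_inverse by (simp add: power2_eq_square algebra_simps)
    then show ?thesis
      using deviation[OF assms, of "x s" "w s + h"] that nonneg(1)[OF assms] by simp
  qed
  from first_order_condition[OF nonneg(2)[OF assms] this]
  show "marginal s \<le> \<alpha> / oa * (sum w S + w s)"
    and "w s > 0 \<Longrightarrow> marginal s = \<alpha> / oa * (sum w S + w s)"
    by (auto simp: D_def)
qed

lemma sum_w_nonneg: "sum w S \<ge> 0"
  using nonneg by (simp add: sum_nonneg)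

text \<open>Open access traffic makes the marginal positive; with \<open>x s = 0\<close> the own
  bands would have no marginal congestion cost to balance it.\<close>

lemma x_pos_if_w_pos:
  assumes "s \<in> S" "w s > 0"
  shows "x s > 0"
proof -
  have "0 < \<alpha> / oa * (sum w S + w s)"
    using \<alpha> oa sum_w_nonneg assms by simp
  also have "\<dots> \<le> 2 * \<alpha> * (x s / (b s + v s))"
    using w_condition(2)[OF assms] x_condition(1)[OF assms(1)] by simp
  finally show ?thesis
    using nonneg(1)[OF assms(1)] by (cases "x s = 0") auto
qed

text \<open>A provider active on its own bands has a positive marginal, which keeps the total below
  1; if there is none, nobody carries any traffic.\<close>

lemma total_less_1: "(\<Sum>r\<in>S. x r + w r) < 1"
proof (cases "\<exists>s\<in>S. x s > 0")
  case True
  then obtain s where s: "s \<in> S" "x s > 0" by blast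
  have "marginal s > 0"
    using x_condition(2)[OF s] s b[of s] v[of s] \<alpha> by simp
  moreover have "(x s + w s) * (1 + 2 * (1 - \<alpha>) / b s) \<ge> 0"
    using nonneg[OF s(1)] b[OF s(1)] \<alpha> by simp
  ultimately show ?thesis
    unfolding marginal_def by linarith
next
  case False
  have "x s + w s = 0" if "s \<in> S" for s
    using False x_pos_if_w_pos[OF that] nonneg[OF that] that by force
  then show ?thesis by simp
qed

lemma x_pos:
  assumes "s \<in> S"
  shows "x s > 0"
proof (rule ccontr)
  assume "\<not> x s > 0"
  then have "x s = 0" "w s = 0"
    using nonneg[OF assms] x_pos_if_w_pos[OF assms] by force+
  \<comment> \<open>The marginal of an idle provider is the delivered price, which is
    positive.\<close>
  then show False
    using x_condition(1)[OF assms] total_less_1 by (simp add: marginal_def)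
qed

lemma marginal_eq: "s \<in> S \<Longrightarrow> marginal s = 2 * \<alpha> * (x s / (b s + v s))"
  using x_condition(2) x_pos by blast

text \<open>No equilibrium quantity survives: all traffic is bounded in terms of \<open>t\<close>,
  which is then cancelled. The congestion terms with factor \<open>2 * \<alpha>\<close> cancel up to
  \<open>2 * \<alpha> / N\<close>.\<close>

lemma open_access_bound:
  fixes B V :: real
  assumes s: "s \<in> S" "w s > 0"
    and T: "T \<subseteq> S" "card T = N" "N > 0"
    and bw: "\<And>r. r \<in> T \<Longrightarrow> b r = B / real N" "\<And>r. r \<in> T \<Longrightarrow> v r = V / real N"
    and BV: "B > 0" "V \<ge> 0"
  shows "(b s + v s) * (1 + 2 * (1 - \<alpha>) / b s) \<le>
    ((B + V) * (1 + 1 / N) + 2 * oa) * (1 / N + 2 * (1 - \<alpha>) / B) + 2 * \<alpha> / N"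
proof -
  define n where "n = real N"
  have n: "n > 0" using T by (simp add: n_def)
  define t where "t = x s / (b s + v s)"
  define XT where "XT = sum x T"
  define wT where "wT = sum w T"
  define P where "P = 1 - (\<Sum>r\<in>S. x r + w r)"
  define \<Omega> where "\<Omega> = sum w S"
  have bv: "b s > 0" "v s \<ge> 0" using b v s by auto
  then have t: "t > 0" using x_pos[OF s(1)] by (simp add: t_def)
  have xs: "x s = (b s + v s) * t" using bv by (simp add: t_def)
  have "\<alpha> * (2 * oa * t) = \<alpha> * (\<Omega> + w s)"
    using w_condition(2)[OF s] marginal_eq[OF s(1)] oa
    by (simp add: t_def[symmetric] \<Omega>_def field_simps)
  then have \<Omega>: "2 * oa * t = \<Omega> + w s"
    using \<alpha> by simp
  have wT: "0 \<le> wT" "wT \<le> \<Omega>"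
    unfolding wT_def \<Omega>_def using T nonneg finite_S
    by (auto intro!: sum_nonneg sum_mono2)
  have XT: "0 \<le> XT"
    unfolding XT_def using T nonneg by (auto intro!: sum_nonneg)
  \<comment> \<open>Equal bandwidths give all members of \<open>T\<close> the same coefficient, so
    only the aggregate \<open>XT\<close> matters and no symmetry of the equilibrium is
    assumed.\<close>
  have marginal_T: "(\<Sum>r\<in>T. marginal r) = 2 * \<alpha> * (XT * n / (B + V))"
  proof -
    have "(\<Sum>r\<in>T. marginal r) = (\<Sum>r\<in>T. 2 * \<alpha> * (n / (B + V)) * x r)"
      using bw T n by (intro sum.cong) (auto simp: marginal_eq n_def add_divide_distrib[symmetric])
    also have "\<dots> = 2 * \<alpha> * (XT * n / (B + V))"
      unfolding sum_distrib_left[symmetric] XT_def by simp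
    finally show ?thesis .
  qed
  have T_eq: "n * P - (XT + wT) * (1 + 2 * (1 - \<alpha>) * n / B) = 2 * \<alpha> * (XT * n / (B + V))"
  proof -
    have "(\<Sum>r\<in>T. marginal r) = (\<Sum>r\<in>T. P - (x r + w r) * (1 + 2 * (1 - \<alpha>) * n / B))"
      using bw by (intro sum.cong) (auto simp: marginal_def P_def n_def)
    also have "\<dots> = n * P - (XT + wT) * (1 + 2 * (1 - \<alpha>) * n / B)"
      using T by (simp add: sum_subtractf n_def XT_def wT_def sum.distrib
          sum_distrib_right[symmetric] del: distrib_left distrib_right)
    finally show ?thesis using marginal_T by simp
  qed
  have T_le: "2 * \<alpha> * (XT * n / (B + V)) \<le> \<alpha> / oa * (n * \<Omega> + wT)"
  proof -
    have "2 * \<alpha> * (XT * n / (B + V)) = (\<Sum>r\<in>T. marginal r)"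
      using marginal_T by simp
    also have "\<dots> \<le> (\<Sum>r\<in>T. \<alpha> / oa * (\<Omega> + w r))"
      using T w_condition(1) by (intro sum_mono) (auto simp: \<Omega>_def)
    also have "\<dots> = \<alpha> / oa * (n * \<Omega> + wT)"
      using T unfolding sum_distrib_left[symmetric] sum.distrib n_def wT_def by simp
    finally show ?thesis .
  qed
  \<comment> \<open>Since \<open>\<Omega>\<close> and \<open>wT\<close> are both at most
    \<open>2 * oa * t\<close>, the right side of \<open>T_le\<close> is at most
    \<open>2 * \<alpha> * (n + 1) * t\<close>; the summand \<open>1 / n\<close> comes from
    \<open>wT\<close>.\<close>
  have XT_t: "XT / (B + V) \<le> t * (1 + 1 / n)"
  proof -
    have "(\<alpha> / oa) * (2 * (XT * n / (B + V)) * oa) = 2 * \<alpha> * (XT * n / (B + V))"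
      using oa by simp
    also note T_le
    finally have "2 * (XT * n / (B + V)) * oa \<le> n * \<Omega> + wT"
      using \<alpha> oa by (subst (asm) mult_le_cancel_left_pos) auto
    also have "\<dots> \<le> n * (2 * oa * t) + 2 * oa * t"
      using \<Omega> wT s n by (intro add_mono mult_left_mono) auto
    finally have "(2 * oa) * (n * (XT / (B + V))) \<le> (2 * oa) * (n * (t * (1 + 1 / n)))"
      using n by (simp add: algebra_simps)
    then have "n * (XT / (B + V)) \<le> n * (t * (1 + 1 / n))"
      using oa by (subst (asm) mult_le_cancel_left_pos) auto
    then show ?thesis
      using n by (subst (asm) mult_le_cancel_left_pos) auto
  qed
  have factor_t: "(g * t) * e + 2 * \<alpha> * (t * (1 + 1 / n)) - 2 * \<alpha> * t = t * (g * e + 2 * \<alpha> / n)" for g e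
    by (simp add: algebra_simps)
  have "(b s + v s) * t * (1 + 2 * (1 - \<alpha>) / b s) \<le> (x s + w s) * (1 + 2 * (1 - \<alpha>) / b s)"
    using xs s \<alpha> bv by (intro mult_right_mono) auto
  also have "\<dots> = P - 2 * \<alpha> * t"
    using marginal_eq[OF s(1)] by (simp add: marginal_def P_def t_def)
  \<comment> \<open>\<open>T_eq\<close> solved for \<open>P\<close>: the same delivered price enters
    the conditions of \<open>s\<close> and of \<open>T\<close>, and is thereby eliminated.\<close>
  also have "P = (XT + wT) * (1 / n + 2 * (1 - \<alpha>) / B) + 2 * \<alpha> * (XT / (B + V))"
  proof -
    have "n * P = (XT + wT) * (1 + 2 * (1 - \<alpha>) * n / B) + 2 * \<alpha> * (XT * n / (B + V))"
      using T_eq by linarith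
    also have "1 + 2 * (1 - \<alpha>) * n / B = n * (1 / n + 2 * (1 - \<alpha>) / B)"
      using n by (simp add: distrib_left)
    finally have "n * P = n * ((XT + wT) * (1 / n + 2 * (1 - \<alpha>) / B) + 2 * \<alpha> * (XT / (B + V)))"
      by (simp only: distrib_left mult_ac times_divide_eq_right)
    then show ?thesis using n by simp
  qed
  also have "\<dots> - 2 * \<alpha> * t \<le>
      (((B + V) * (1 + 1 / n) + 2 * oa) * t) * (1 / n + 2 * (1 - \<alpha>) / B) + 2 * \<alpha> * (t * (1 + 1 / n))
      - 2 * \<alpha> * t"
  proof -
    have "XT \<le> (B + V) * (1 + 1 / n) * t"
      using XT_t BV by (simp add: field_simps)
    moreover have "wT \<le> 2 * oa * t"
      using wT \<Omega> s by simp
    ultimately have "XT + wT \<le> ((B + V) * (1 + 1 / n) + 2 * oa) * t"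
      by (simp add: algebra_simps)
    then show ?thesis
      using XT_t \<alpha> n BV by (intro diff_right_mono add_mono mult_right_mono mult_left_mono) auto
  qed
  also have "\<dots> = t * (((B + V) * (1 + 1 / n) + 2 * oa) * (1 / n + 2 * (1 - \<alpha>) / B) + 2 * \<alpha> / n)"
    by (rule factor_t)
  finally have "t * ((b s + v s) * (1 + 2 * (1 - \<alpha>) / b s)) \<le> \<dots>"
    by (simp add: mult_ac)
  then show ?thesis
    using t by (simp add: n_def)
qed

end


text \<open>The right side of \<open>open_access_bound\<close> tends to the left side of
  \<open>gap\<close>, hence drops below \<open>l\<close> eventually. The bound \<open>l\<close> is
  uniform in \<open>N\<close>, as the bandwidths in \<open>R N\<close> may vary with
  \<open>N\<close>.\<close>

lemma unused_open_access_eventually: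
  fixes S T R :: "nat \<Rightarrow> 's set" and b v :: "nat \<Rightarrow> 's \<Rightarrow> real"
  assumes game: "\<And>N. N > 0 \<Longrightarrow> cournot_game \<alpha> oa (S N) (b N) (v N)"
    and R: "\<And>N. N > 0 \<Longrightarrow> R N \<subseteq> S N"
    and T: "\<And>N. N > 0 \<Longrightarrow> T N \<subseteq> S N" "\<And>N. card (T N) = N"
    and bw: "\<And>N r. r \<in> T N \<Longrightarrow> b N r = B / real N"
      "\<And>N r. r \<in> T N \<Longrightarrow> v N r = V / real N"
    and BV: "B > 0" "V \<ge> 0"
    and l: "\<And>N s. N > 0 \<Longrightarrow> s \<in> R N \<Longrightarrow>
      l \<le> (b N s + v N s) * (1 + 2 * (1 - \<alpha>) / b N s)"
    and gap: "(B + V + 2 * oa) * (2 * (1 - \<alpha>) / B) < l"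
  shows "\<exists>Nstar. \<forall>N\<ge>Nstar. unused_open_access_at_equilibrium \<alpha> oa (S N) (b N) (v N) (R N)"
proof -
  let ?u = "\<lambda>N. ((B + V) * (1 + 1 / real N) + 2 * oa) * (1 / real N + 2 * (1 - \<alpha>) / B)
    + 2 * \<alpha> / real N"
  have "?u \<longlonglongrightarrow> ((B + V) * (1 + 0) + 2 * oa) * (0 + 2 * (1 - \<alpha>) / B) + 0"
    by (intro tendsto_intros lim_const_over_n)
  then have "\<forall>\<^sub>F N in sequentially. ?u N < l"
    by (rule order_tendstoD(2)) (use gap in simp)
  \<comment> \<open>At \<open>N = 0\<close>, division by zero gives \<open>?u\<close> its limit
    value, so \<open>?u N < l\<close> does not exclude this case.\<close>
  then have "\<forall>\<^sub>F N in sequentially. N > 0 \<and> ?u N < l"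
    by (intro eventually_conj eventually_gt_at_top)
  then obtain M where M: "\<And>N. N \<ge> M \<Longrightarrow> N > 0 \<and> ?u N < l"
    by (auto simp: eventually_sequentially)
  show ?thesis
  proof (intro exI[of _ M] allI impI)
    fix N assume "N \<ge> M"
    then have N: "N > 0" "?u N < l" using M by auto
    interpret cournot_game \<alpha> oa "S N" "b N" "v N"
      using game N by blast
    have "w s = 0" if eq: "nash_equilibrium \<alpha> oa (S N) (b N) (v N) x w" and "s \<in> R N" for x w s
    proof (rule ccontr)
      interpret cournot_equilibrium \<alpha> oa "S N" "b N" "v N" x w
        by unfold_locales (rule eq)
      have "s \<in> S N" using R N that by blast
      moreover assume "w s \<noteq> 0"
      ultimately have s: "s \<in> S N" "w s > 0"
        using nonneg(2)[of s] by auto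
      show False
        using open_access_bound[OF s T N(1) bw BV] l[OF N(1) that(2)] N by simp
    qed
    then show "unused_open_access_at_equilibrium \<alpha> oa (S N) (b N) (v N) (R N)"
      using nash_equilibrium_exists unfolding unused_open_access_at_equilibrium_def by blast
  qed
qed

section \<open>Application to the two scenarios\<close>

theorem theorem5p1:
  fixes B V :: "nat \<Rightarrow> real" and W \<alpha> \<beta> :: real
  assumes "B 1 > 0" and "B 2 > 0" and "W > 0"
    and "0 < \<alpha>" and "\<alpha> \<le> 1" and "0 < \<beta>" and "\<beta> \<le> 1"
    and "V 1 \<ge> 0" and "V 2 \<ge> 0" and "V 1 + V 2 = (1 - \<beta>) * W"
  shows
    "(B 1 + V 1 + 2 * (1 - \<alpha>) * (V 1 / B 1) > 2 * (1 - \<alpha>) * ((2 * \<beta> * W + V 2) / B 2) \<longrightarrow>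
        (\<exists>Nstar. \<forall>N\<ge>Nstar.
           unused_open_access_at_equilibrium \<alpha> (\<beta> * W)
             (one_large_sps N) (one_large_bw B N) (one_large_bw V N) {1}))
     \<and>
     (\<alpha> < 1 \<and> B 1 \<ge> B 2 \<longrightarrow>
        (\<forall>i\<in>{1, 2}. \<forall>j\<in>{1, 2}. i \<noteq> j \<and> V i / B i > (2 * \<beta> * W + V j) / B j \<longrightarrow>
           (\<exists>Nstar. \<forall>N\<ge>Nstar.
              unused_open_access_at_equilibrium \<alpha> (\<beta> * W)
                (two_group_sps N) (two_group_bw B N) (two_group_bw V N) ({i} \<times> {1..N}))))"
proof (intro conjI impI ballI)
  assume gap: "B 1 + V 1 + 2 * (1 - \<alpha>) * (V 1 / B 1) > 2 * (1 - \<alpha>) * ((2 * \<beta> * W + V 2) / B 2)"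
  show "\<exists>Nstar. \<forall>N\<ge>Nstar. unused_open_access_at_equilibrium \<alpha> (\<beta> * W)
    (one_large_sps N) (one_large_bw B N) (one_large_bw V N) {1}"
  proof (rule unused_open_access_eventually[where T = "\<lambda>N. {2..N + 1}" and B = "B 2" and V = "V 2"
        and l = "(B 1 + V 1) * (1 + 2 * (1 - \<alpha>) / B 1)"])
    show "cournot_game \<alpha> (\<beta> * W) (one_large_sps N) (one_large_bw B N) (one_large_bw V N)" if "N > 0" for N
      using assms that by unfold_locales (auto simp: one_large_sps_def one_large_bw_def)
    \<comment> \<open>Both sides of the hypothesis are shifted by \<open>2 * (1 - \<alpha>)\<close>,
      the contribution of \<open>B 2 / B 2\<close> and \<open>B 1 / B 1\<close>.\<close>
    have "(B 2 + V 2 + 2 * (\<beta> * W)) * (2 * (1 - \<alpha>) / B 2)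
        = 2 * (1 - \<alpha>) + 2 * (1 - \<alpha>) * ((2 * \<beta> * W + V 2) / B 2)"
      using assms by (simp add: field_simps)
    also have "\<dots> < 2 * (1 - \<alpha>) + (B 1 + V 1 + 2 * (1 - \<alpha>) * (V 1 / B 1))"
      using gap by simp
    also have "\<dots> = (B 1 + V 1) * (1 + 2 * (1 - \<alpha>) / B 1)"
      using assms by (simp add: field_simps)
    finally show "(B 2 + V 2 + 2 * (\<beta> * W)) * (2 * (1 - \<alpha>) / B 2) < \<dots>" .
  qed (use assms in \<open>auto simp: one_large_sps_def one_large_bw_def\<close>)
next
  fix i j
  assume ij: "i \<in> {1, 2}" "j \<in> {1, 2}"
    and "\<alpha> < 1 \<and> B 2 \<le> B 1" and gap: "i \<noteq> j \<and> (2 * \<beta> * W + V j) / B j < V i / B i"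
  then have "\<alpha> < 1" by simp
  have BV: "B i > 0" "V i \<ge> 0" "B j > 0" "V j \<ge> 0" using ij assms by auto
  show "\<exists>Nstar. \<forall>N\<ge>Nstar. unused_open_access_at_equilibrium \<alpha> (\<beta> * W)
    (two_group_sps N) (two_group_bw B N) (two_group_bw V N) ({i} \<times> {1..N})"
  \<comment> \<open>Here \<open>l\<close> omits the positive term \<open>(B i + V i) / N\<close>,
    which vanishes in the limit.\<close>
  proof (rule unused_open_access_eventually[where T = "\<lambda>N. {j} \<times> {1..N}" and B = "B j" and V = "V j"
        and l = "(B i + V i) * (2 * (1 - \<alpha>) / B i)"])
    show "cournot_game \<alpha> (\<beta> * W) (two_group_sps N) (two_group_bw B N) (two_group_bw V N)" if "N > 0" for N
      using assms that by unfold_locales (auto simp: two_group_sps_def two_group_bw_def)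
    show "(B i + V i) * (2 * (1 - \<alpha>) / B i) \<le> (two_group_bw B N s + two_group_bw V N s)
        * (1 + 2 * (1 - \<alpha>) / two_group_bw B N s)" if "N > 0" "s \<in> {i} \<times> {1..N}" for N s
    proof -
      have "(two_group_bw B N s + two_group_bw V N s) * (1 + 2 * (1 - \<alpha>) / two_group_bw B N s)
        = (B i + V i) * (2 * (1 - \<alpha>) / B i) + (B i + V i) / real N"
        using that BV by (auto simp: two_group_bw_def field_simps)
      then show ?thesis
        using that BV by simp
    qed
    have "(B j + V j + 2 * (\<beta> * W)) * (2 * (1 - \<alpha>) / B j)
        = 2 * (1 - \<alpha>) * (1 + (2 * \<beta> * W + V j) / B j)"
      using BV by (simp add: field_simps)
    \<comment> \<open>Strictness survives because \<open>\<alpha> < 1\<close> makes the factor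
      positive; at \<open>\<alpha> = 1\<close> both sides would be 0.\<close>
    also have "\<dots> < 2 * (1 - \<alpha>) * (1 + V i / B i)"
      using gap \<open>\<alpha> < 1\<close> by simp
    also have "\<dots> = (B i + V i) * (2 * (1 - \<alpha>) / B i)"
      using BV by (simp add: field_simps)
    finally show "(B j + V j + 2 * (\<beta> * W)) * (2 * (1 - \<alpha>) / B j) < \<dots>" .
  qed (use BV ij in \<open>auto simp: two_group_sps_def two_group_bw_def card_cartesian_product\<close>)
qed

end
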